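(* For every digraph $G$, we have $\gamma^*(G) \leq 2\alpha(G)$.
   Context: All digraphs are finite, loopless and simple, where simple means that for any two vertices $u,v$ there is at most one arc with endpoints $\{u,v\}$. The independence number $\alpha(G)$ of a digraph $G$ is the independence number of its underlying undirected graph. For a vertex $v$, $N^-(v)$ denotes the set of in-neighbors of $v$ and $N^-[v]=N^-(v)\cup\{v\}$. A fractional dominating function of $G=(V,E)$ is a function $g:V\to[0,1]$ such that $\sum_{x\in N^-[v]} g(x)\ge 1$ for every $v\in V$. The fractional domination number $\gamma^*(G)$ is the minimum of $\sum_{v\in V} g(v)$ over all fractional dominating functions $g$ of $G$. *)

theory Defs
  imports "HOL-Analysis.Analysis" "Graph_Theory.Digraph_Component"
begin

text \<open>
  The library locale \<^locale>\<open>digraph\<close> forbids loops and parallel arcs but allows a pair of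
  opposite arcs. Here the endpoints are compared as an unordered pair, so that opposite arcs are
  excluded as well. As in the library, the null digraph is allowed.
\<close>

locale simple_digraph = fin_digraph + loopfree_digraph +
  assumes at_most_one_arc:
    "\<lbrakk>e1 \<in> arcs G; e2 \<in> arcs G; {tail G e1, head G e1} = {tail G e2, head G e2}\<rbrakk> \<Longrightarrow> e1 = e2"

text \<open>
  Undirected graphs are symmetric digraphs in the library, and the symmetric closure
  \<^const>\<open>mk_symmetric\<close> yields the underlying undirected graph of a digraph.
\<close>

definition independent_set :: "('a, 'b) pre_digraph \<Rightarrow> 'a set \<Rightarrow> bool" where
  "independent_set H S \<longleftrightarrow> S \<subseteq> verts H \<and> (\<forall>u\<in>S. \<forall>v\<in>S. \<not> u \<rightarrow>\<^bsub>H\<^esub> v)"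

definition independence_number :: "('a, 'b) pre_digraph \<Rightarrow> nat" where
  "independence_number G = Max (card ` {S. independent_set (with_proj (mk_symmetric G)) S})"

definition in_neighbors :: "('a, 'b) pre_digraph \<Rightarrow> 'a \<Rightarrow> 'a set" where
  "in_neighbors G v = {u \<in> verts G. u \<rightarrow>\<^bsub>G\<^esub> v}"

definition closed_in_neighbors :: "('a, 'b) pre_digraph \<Rightarrow> 'a \<Rightarrow> 'a set" where
  "closed_in_neighbors G v = in_neighbors G v \<union> {v}"

text \<open>
  Only the values of \<open>g\<close> on the vertices matter; \<open>g\<close> is unconstrained elsewhere.
\<close>

definition fractional_dominating_function :: "('a, 'b) pre_digraph \<Rightarrow> ('a \<Rightarrow> real) \<Rightarrow> bool" where
  "fractional_dominating_function G g \<longleftrightarrow>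
     (\<forall>v\<in>verts G. g v \<in> {0..1}) \<and>
     (\<forall>v\<in>verts G. (\<Sum>x\<in>closed_in_neighbors G v. g x) \<ge> 1)"

text \<open>
  The infimum is a minimum, see \<open>fractional_domination_number_attained\<close> below.
\<close>

definition fractional_domination_number :: "('a, 'b) pre_digraph \<Rightarrow> real" where
  "fractional_domination_number G =
     Inf ((\<lambda>g. \<Sum>v\<in>verts G. g v) ` {g. fractional_dominating_function G g})"

lemma independent_set_mk_symmetric_iff:
  "independent_set (with_proj (mk_symmetric G)) S \<longleftrightarrow>
     S \<subseteq> verts G \<and> (\<forall>u\<in>S. \<forall>v\<in>S. \<not> u \<rightarrow>\<^bsub>G\<^esub> v)"
  unfolding independent_set_def mk_symmetric_def
  by (auto simp: arcs_ends_conv)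

lemma (in fin_digraph) independence_number_attained:
  obtains S where "independent_set (with_proj (mk_symmetric G)) S" "card S = independence_number G"
proof -
  let ?F = "{S. independent_set (with_proj (mk_symmetric G)) S}"
  have "?F \<subseteq> Pow (verts G)" by (auto simp: independent_set_mk_symmetric_iff)
  then have "finite ?F" by (rule finite_subset) simp
  moreover have "{} \<in> ?F" by (simp add: independent_set_mk_symmetric_iff)
  ultimately have "independence_number G \<in> card ` ?F"
    unfolding independence_number_def by (intro Max_in) auto
  with that show ?thesis by auto
qed

lemma (in fin_digraph) fractional_domination_number_attained:
  obtains g where "fractional_dominating_function G g"
    "(\<Sum>v\<in>verts G. g v) = fractional_domination_number G"
    "\<And>h. fractional_dominating_function G h \<Longrightarrow> (\<Sum>v\<in>verts G. g v) \<le> (\<Sum>v\<in>verts G. h v)"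
proof -
  let ?w = "\<lambda>g::'a \<Rightarrow> real. \<Sum>v\<in>verts G. g v"
  define B where "B = (PiE UNIV (\<lambda>_. {0..1}) :: ('a \<Rightarrow> real) set)"
  define K where "K = B \<inter> (\<Inter>v\<in>verts G. {g. 1 \<le> (\<Sum>x\<in>closed_in_neighbors G v. g x)})"
  have sub: "closed_in_neighbors G v \<subseteq> verts G" if "v \<in> verts G" for v
    using that by (auto simp: closed_in_neighbors_def in_neighbors_def)
  have "compactin (product_topology (\<lambda>_. euclidean) UNIV) B"
    unfolding B_def by (subst compactin_PiE) auto
  then have comp: "compact B" by (simp add: euclidean_product_topology)
  have cont: "continuous_on UNIV (\<lambda>g::'a \<Rightarrow> real. \<Sum>x\<in>A. g x)" for A
    by (intro continuous_intros) (rule continuous_on_product_coordinates)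
  have "closed (\<Inter>v\<in>verts G. {g::'a \<Rightarrow> real. 1 \<le> (\<Sum>x\<in>closed_in_neighbors G v. g x)})"
    by (intro closed_INT ballI closed_Collect_le cont continuous_on_const)
  with comp have "compact K" unfolding K_def by (rule compact_Int_closed)
  moreover have "(\<lambda>_. 1) \<in> K"
  proof -
    have "1 \<le> card (closed_in_neighbors G v)" if "v \<in> verts G" for v
      using finite_subset[OF sub[OF that]] by (auto simp: closed_in_neighbors_def Suc_le_eq card_gt_0_iff)
    then show ?thesis by (auto simp: K_def B_def)
  qed
  moreover have "continuous_on K ?w" using cont continuous_on_subset by blast
  ultimately obtain g where g: "g \<in> K" "\<And>h. h \<in> K \<Longrightarrow> ?w g \<le> ?w h"
    using continuous_attains_inf[of K ?w] by blast
  have fg: "fractional_dominating_function G g"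
    using g(1) by (auto simp: fractional_dominating_function_def K_def B_def PiE_iff)
  have min: "?w g \<le> ?w h" if h: "fractional_dominating_function G h" for h
  proof -
    let ?h = "\<lambda>v. if v \<in> verts G then h v else 0"
    have "(\<Sum>x\<in>closed_in_neighbors G v. ?h x) = (\<Sum>x\<in>closed_in_neighbors G v. h x)"
      if "v \<in> verts G" for v
      using sub[OF that] by (intro sum.cong) auto
    then have "?h \<in> K" using h by (auto simp: fractional_dominating_function_def K_def B_def)
    from g(2)[OF this] show ?thesis by simp
  qed
  have "?w g = fractional_domination_number G"
    unfolding fractional_domination_number_def
    using fg min by (intro cInf_eq_minimum[symmetric]) auto
  with that fg min show ?thesis by blast
qed

end

theory Submission
  imports Defs
begin

text \<open>
  If no probability distribution gives every closed in-neighborhood mass at least \<open>1 / (2 * \<alpha>)\<close>,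
  then by Ville's theorem of the alternative there are nonnegative weights \<open>w\<close> of total \<open>W > 0\<close> for
  which every closed out-neighborhood has weight less than \<open>W / (2 * \<alpha>)\<close>. Averaging with respect
  to \<open>w\<close> gives \<open>(\<Sum>v. w v ^ 2) + (\<Sum>u \<rightarrow> v. w u * w v) < W ^ 2 / (2 * \<alpha>)\<close>, whereas the weighted
  Turan inequality of Motzkin and Straus says
  \<open>(\<Sum>v. w v ^ 2) + 2 * (\<Sum>u \<rightarrow> v. w u * w v) \<ge> W ^ 2 / \<alpha>\<close>, a contradiction.
\<close>

section \<open>Theorem of the alternative by least squares\<close>

lemma compact_prob_simplex:
  fixes V :: "'a set"
  shows "compact {p :: 'a \<Rightarrow> real. (\<forall>v. p v \<in> {0..1}) \<and> (\<Sum>v\<in>V. p v) = 1}"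
proof -
  \<comment> \<open>The box also bounds the coordinates outside \<open>V\<close>, so that
    Tychonoff's theorem gives compactness in the full function space.\<close>
  let ?B = "PiE UNIV (\<lambda>_. {0..1}) :: ('a \<Rightarrow> real) set"
  have "compactin (product_topology (\<lambda>_. euclidean) UNIV) ?B"
    by (subst compactin_PiE) auto
  then have "compact ?B" by (simp add: euclidean_product_topology)
  moreover have "closed {p :: 'a \<Rightarrow> real. (\<Sum>v\<in>V. p v) = 1}"
    by (intro closed_Collect_eq continuous_intros continuous_on_product_coordinates)
  ultimately have "compact (?B \<inter> {p. (\<Sum>v\<in>V. p v) = 1})" by (rule compact_Int_closed)
  moreover have "?B \<inter> {p. (\<Sum>v\<in>V. p v) = 1} = {p. (\<forall>v. p v \<in> {0..1}) \<and> (\<Sum>v\<in>V. p v) = 1}"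
    by (auto simp: PiE_iff)
  ultimately show ?thesis by simp
qed

text \<open>Bounds the squared positive part by a quadratic in \<open>d\<close> with equality at
  \<open>d = 0\<close>, so that a perturbation can be expanded without differentiating
  \<open>max\<close>.\<close>

lemma max_0_diff_square_le:
  fixes x d :: real
  shows "(max 0 (x - d))\<^sup>2 \<le> (max 0 x - d)\<^sup>2"
  unfolding abs_le_square_iff[symmetric] by linarith

text \<open>Let t tend to 0. This turns the minimality inequality for small steps into a first-order
  condition.\<close>

lemma nonpos_if_le_all_small_multiples:
  fixes a b :: real
  assumes "\<And>t. 0 < t \<Longrightarrow> t \<le> 1 \<Longrightarrow> a \<le> t * b"
  shows "a \<le> 0"
proof (rule ccontr)
  assume "\<not> a \<le> 0"
  then have a: "a > 0" by simp
  \<comment> \<open>Chosen so that \<open>t * b\<close> is at most \<open>a / 2\<close>; the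
    \<open>+ 1\<close> keeps the denominator positive when \<open>b = 0\<close>.\<close>
  define t where "t = min 1 (a / (2 * (\<bar>b\<bar> + 1)))"
  have t: "0 < t" "t \<le> 1" using a by (auto simp: t_def)
  have "t * b \<le> t * (\<bar>b\<bar> + 1)" using t by (intro mult_left_mono) auto
  also have "\<dots> \<le> a / (2 * (\<bar>b\<bar> + 1)) * (\<bar>b\<bar> + 1)"
    by (intro mult_right_mono) (auto simp: t_def)
  also have "\<dots> = a / 2" by (simp add: field_simps)
  finally show False using assms[OF t] a by simp
qed

text \<open>
  The dual weights are the positive parts of the deficits \<open>c - y p v\<close> at a distribution \<open>p\<close>
  minimizing the sum of their squares; strictness comes from \<open>y p v < c\<close> where \<open>w v > 0\<close>.
\<close>

lemma ville_alternative:
  fixes A :: "'a \<Rightarrow> 'a \<Rightarrow> real" and c :: real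
  assumes fin: "finite V" and ne: "V \<noteq> {}"
  obtains (primal) p where "\<And>v. v \<in> V \<Longrightarrow> p v \<ge> 0" "(\<Sum>v\<in>V. p v) = 1"
      "\<And>v. v \<in> V \<Longrightarrow> c \<le> (\<Sum>u\<in>V. A u v * p u)"
  | (dual) w where "\<And>v. v \<in> V \<Longrightarrow> w v \<ge> 0" "(\<Sum>v\<in>V. w v) > 0"
      "\<And>u. u \<in> V \<Longrightarrow> (\<Sum>v\<in>V. A u v * w v) < c * (\<Sum>v\<in>V. w v)"
proof -
  define K where "K = {p :: 'a \<Rightarrow> real. (\<forall>v. p v \<in> {0..1}) \<and> (\<Sum>v\<in>V. p v) = 1}"
  define y where "y p v = (\<Sum>u\<in>V. A u v * p u)" for p v
  define F where "F p = (\<Sum>v\<in>V. (max 0 (c - y p v))\<^sup>2)" for p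
  have "compact K" unfolding K_def by (rule compact_prob_simplex)
  moreover obtain z where z: "z \<in> V" using ne by auto
  have unit: "(\<lambda>v. of_bool (v = u)) \<in> K" if "u \<in> V" for u
    using that fin by (auto simp: K_def of_bool_def)
  then have "K \<noteq> {}" using z by blast
  moreover have "continuous_on K F"
  proof -
    have "continuous_on UNIV F"
      unfolding F_def y_def
      by (intro continuous_intros continuous_on_product_coordinates)
    then show ?thesis using continuous_on_subset by blast
  qed
  ultimately obtain p where pK: "p \<in> K" and pmin: "\<And>q. q \<in> K \<Longrightarrow> F p \<le> F q"
    using continuous_attains_inf[of K F] by blast
  define w where "w v = max 0 (c - y p v)" for v
  have w0: "w v \<ge> 0" for v by (simp add: w_def)
  show ?thesis
  proof (cases "\<forall>v\<in>V. w v = 0")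
    case True
    then have "c \<le> y p v" if "v \<in> V" for v
      using that by (force simp: w_def max_def split: if_splits)
    with pK show ?thesis by (intro primal[of p]) (auto simp: K_def y_def)
  next
    case False
    then obtain v0 where v0: "v0 \<in> V" "w v0 > 0" using w0 by (metis less_eq_real_def)
    then have Wpos: "(\<Sum>v\<in>V. w v) > 0" using w0 fin by (intro sum_pos2[of V v0]) auto
    have "(\<Sum>v\<in>V. A u v * w v) < c * (\<Sum>v\<in>V. w v)" if u: "u \<in> V" for u
    proof -
      define d where "d v = A u v - y p v" for v
      have step: "2 * (\<Sum>v\<in>V. w v * d v) \<le> t * (\<Sum>v\<in>V. (d v)\<^sup>2)" if t: "0 < t" "t \<le> 1" for t
      proof -
        define q where "q v = (1 - t) * p v + t * of_bool (v = u)" for v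
        have "q v \<in> {0..1}" for v
          using pK t convex_bound_le[of "p v" 1 "of_bool (v = u)" "1 - t" t]
          by (auto simp: q_def K_def)
        moreover have "(\<Sum>v\<in>V. q v) = 1"
          using pK u fin
          by (simp add: q_def K_def sum.distrib flip: sum_distrib_left)
        ultimately have "q \<in> K" by (simp add: K_def)
        have yq: "y q v = y p v + t * d v" for v
        proof -
          have "y q v = (1 - t) * y p v + t * (\<Sum>x\<in>V. A x v * of_bool (x = u))"
            unfolding y_def q_def
            by (simp add: algebra_simps sum.distrib sum_subtractf sum_distrib_left)
          also have "(\<Sum>x\<in>V. A x v * of_bool (x = u)) = A u v"
            using u fin by (simp add: of_bool_def if_distrib cong: if_cong)
          finally show ?thesis by (simp add: d_def algebra_simps)
        qed
        have "F p \<le> F q" using \<open>q \<in> K\<close> by (rule pmin)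
        also have "F q \<le> (\<Sum>v\<in>V. (w v - t * d v)\<^sup>2)"
          unfolding F_def w_def yq
          using max_0_diff_square_le[of "c - y p v" "t * d v" for v]
          by (intro sum_mono) (simp add: algebra_simps)
        \<comment> \<open>Since \<open>F p\<close> is the sum of the squares of \<open>w\<close>,
          comparing with \<open>F p \<le> F q\<close> leaves only the linear and quadratic terms in
          \<open>t\<close>, and one factor \<open>t\<close> cancels.\<close>
        also have "\<dots> = F p - t * (2 * (\<Sum>v\<in>V. w v * d v)) + t * (t * (\<Sum>v\<in>V. (d v)\<^sup>2))"
          by (simp add: F_def w_def power2_eq_square algebra_simps sum.distrib sum_subtractf
              sum_distrib_left)
        finally have "t * (2 * (\<Sum>v\<in>V. w v * d v)) \<le> t * (t * (\<Sum>v\<in>V. (d v)\<^sup>2))" by simp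
        with t show ?thesis by (simp only: mult_le_cancel_left_pos)
      qed
      have "2 * (\<Sum>v\<in>V. w v * d v) \<le> 0"
        using step by (rule nonpos_if_le_all_small_multiples)
      then have "(\<Sum>v\<in>V. A u v * w v) \<le> (\<Sum>v\<in>V. w v * y p v)"
        by (simp add: d_def algebra_simps sum_subtractf)
      also have "\<dots> < (\<Sum>v\<in>V. w v * c)"
      proof (rule sum_strict_mono_ex1)
        show "\<forall>v\<in>V. w v * y p v \<le> w v * c"
          by (auto simp: w_def max_def intro!: mult_left_mono)
        show "\<exists>v\<in>V. w v * y p v < w v * c"
          using v0 by (intro bexI[of _ v0]) (auto simp: w_def max_def split: if_splits)
      qed (rule fin)
      also have "\<dots> = c * (\<Sum>v\<in>V. w v)" by (simp add: sum_distrib_left mult.commute)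
      finally show ?thesis .
    qed
    with w0 Wpos show ?thesis by (intro dual[of w]) auto
  qed
qed

section \<open>Weighted Turan inequality, symmetric and oriented\<close>

text \<open>
  Greedy construction: put a vertex \<open>u\<close> whose closed neighborhood has minimum weight \<open>D\<close> into \<open>I\<close>
  and delete that neighborhood, which contributes at least \<open>D * D\<close> to the quadratic form.
\<close>

lemma weighted_turan:
  fixes w :: "'a \<Rightarrow> real"
  assumes "finite S" and w0: "\<And>v. v \<in> S \<Longrightarrow> w v \<ge> 0"
    and refl: "\<And>u. u \<in> S \<Longrightarrow> R u u" and sym: "\<And>u v. R u v \<Longrightarrow> R v u"
  obtains I where "I \<subseteq> S" "\<And>u v. u \<in> I \<Longrightarrow> v \<in> I \<Longrightarrow> R u v \<Longrightarrow> u = v"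
    "(\<Sum>v\<in>S. w v)\<^sup>2 \<le> card I * (\<Sum>u\<in>S. w u * (\<Sum>v | v \<in> S \<and> R u v. w v))"
proof -
  have "\<exists>I\<subseteq>S. (\<forall>u\<in>I. \<forall>v\<in>I. R u v \<longrightarrow> u = v) \<and>
    (\<Sum>v\<in>S. w v)\<^sup>2 \<le> card I * (\<Sum>u\<in>S. w u * (\<Sum>v | v \<in> S \<and> R u v. w v))"
    using assms(1) w0 refl
  proof (induction S rule: finite_psubset_induct)
    case (psubset S)
    show ?case
    proof (cases "S = {}")
      case False
      define N where "N u = (\<Sum>v | v \<in> S \<and> R u v. w v)" for u
      obtain u where u: "u \<in> S" and umin: "\<And>x. x \<in> S \<Longrightarrow> N u \<le> N x"
        using ex_is_arg_min_if_finite[OF psubset.hyps False, of N]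
        by (auto simp: is_arg_min_linorder)
      define B where "B = {v \<in> S. R u v}"
      define T where "T = S - B"
      define Q where "Q = (\<Sum>x\<in>T. w x * (\<Sum>v | v \<in> T \<and> R x v. w v))"
      have "u \<in> B" using u psubset.prems by (auto simp: B_def)
      then have "T \<subset> S" using u by (auto simp: T_def)
      then obtain I where I: "I \<subseteq> T" "\<forall>u\<in>I. \<forall>v\<in>I. R u v \<longrightarrow> u = v"
        "(\<Sum>v\<in>T. w v)\<^sup>2 \<le> card I * Q"
        using psubset.IH[of T] psubset.prems unfolding Q_def by blast
      have fin: "finite S" "finite B" "finite T" "finite I"
        using psubset.hyps I(1) by (auto simp: B_def T_def intro: finite_subset)
      have w0: "w v \<ge> 0" if "v \<in> S" for v using that psubset.prems by auto
      define D where "D = (\<Sum>v\<in>B. w v)"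
      define W where "W = (\<Sum>v\<in>T. w v)"
      have ND: "N u = D" by (simp add: N_def D_def B_def)
      have tot: "(\<Sum>v\<in>S. w v) = D + W"
        unfolding D_def W_def T_def
        using sum.subset_diff[of B S w] fin by (simp add: B_def Collect_restrict)
      \<comment> \<open>Each \<open>x\<close> in \<open>B\<close> has
        \<open>N x \<ge> N u = D\<close> by the choice of \<open>u\<close>, and \<open>B\<close> has
        weight \<open>D\<close>. For \<open>x\<close> in \<open>T\<close>, restricting the inner sum
        to \<open>T\<close> only drops nonnegative terms.\<close>
      have "D * D + Q \<le> (\<Sum>x\<in>B. w x * N x) + (\<Sum>x\<in>T. w x * N x)"
      proof (rule add_mono)
        have "D * D = (\<Sum>x\<in>B. w x * N u)" by (simp add: ND flip: sum_distrib_right) (simp add: D_def)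
        also have "\<dots> \<le> (\<Sum>x\<in>B. w x * N x)"
          using w0 umin by (intro sum_mono mult_left_mono) (auto simp: B_def)
        finally show "D * D \<le> (\<Sum>x\<in>B. w x * N x)" .
        show "Q \<le> (\<Sum>x\<in>T. w x * N x)"
          unfolding Q_def N_def using w0 fin
          by (intro sum_mono mult_left_mono sum_mono2) (auto simp: T_def)
      qed
      also have "\<dots> = (\<Sum>x\<in>S. w x * N x)"
        unfolding T_def
        using sum.subset_diff[of B S "\<lambda>x. w x * N x"] fin by (simp add: B_def Collect_restrict)
      finally have QS: "D * D + Q \<le> (\<Sum>x\<in>S. w x * N x)" .
      have Q0: "Q \<ge> 0" unfolding Q_def using w0 by (auto simp: T_def intro!: sum_nonneg mult_nonneg_nonneg)
      define k where "k = real (card I)"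
      have WQ: "W\<^sup>2 \<le> k * Q" using I(3) by (simp add: W_def k_def)
      \<comment> \<open>This is what remains of
        \<open>(D + W)\<^sup>2 \<le> (k + 1) * (D * D + Q)\<close> once
        \<open>W\<^sup>2 \<le> k * Q\<close> and the term \<open>D * D\<close> are removed. It
        follows from the arithmetic-geometric mean inequality for \<open>W\<close> and
        \<open>k * D\<close>, after division by \<open>k\<close>; if \<open>k = 0\<close>, then
        \<open>W = 0\<close>.\<close>
      have cross: "2 * D * W \<le> Q + k * D\<^sup>2"
      proof (cases "k = 0")
        case True
        with WQ Q0 show ?thesis by simp
      next
        case False
        then have k: "k > 0" by (simp add: k_def)
        have "k * (2 * D * W) \<le> W\<^sup>2 + (k * D)\<^sup>2"
          using sum_squares_bound[of W "k * D"] by (simp add: algebra_simps)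
        also have "\<dots> \<le> k * (Q + k * D\<^sup>2)" using WQ by (simp add: power2_eq_square algebra_simps)
        finally show ?thesis using k by simp
      qed
      have "(D + W)\<^sup>2 \<le> (k + 1) * (D * D + Q)"
        using cross WQ by (simp add: power2_eq_square algebra_simps)
      also have "\<dots> \<le> (k + 1) * (\<Sum>x\<in>S. w x * N x)"
        using QS by (intro mult_left_mono) (auto simp: k_def)
      also have "k + 1 = card (insert u I)"
        using I(1) fin \<open>u \<in> B\<close> by (auto simp: k_def T_def card_insert_if)
      finally have "(\<Sum>v\<in>S. w v)\<^sup>2 \<le> card (insert u I) * (\<Sum>x\<in>S. w x * N x)" by (simp add: tot)
      \<comment> \<open>\<open>I\<close> lies in \<open>T\<close>, which avoids all neighbors of
        \<open>u\<close>.\<close>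
      moreover have "\<forall>x\<in>insert u I. \<forall>v\<in>insert u I. R x v \<longrightarrow> x = v"
        using I(1,2) sym by (auto simp: T_def B_def)
      moreover have "insert u I \<subseteq> S" using I(1) u by (auto simp: T_def)
      ultimately show ?thesis unfolding N_def by blast
    qed simp
  qed
  then show thesis using that by blast
qed

text \<open>The indicator of the symmetrized relation is at most the sum of the indicators of its
  two directions. Both directions give the same double sum after swapping the variables, hence the
  factor 2.\<close>

lemma weighted_turan_oriented:
  fixes w :: "'a \<Rightarrow> real"
  assumes fin: "finite S" and w0: "\<And>v. v \<in> S \<Longrightarrow> w v \<ge> 0"
  obtains I where "I \<subseteq> S" "\<And>u v. u \<in> I \<Longrightarrow> v \<in> I \<Longrightarrow> E u v \<Longrightarrow> u = v"
    "(\<Sum>v\<in>S. w v)\<^sup>2 \<le> 2 * card I * (\<Sum>u\<in>S. w u * (\<Sum>v\<in>S. of_bool (u = v \<or> E u v) * w v))"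
proof -
  let ?A = "\<lambda>u v. u = v \<or> E u v"
  define R where "R u v \<longleftrightarrow> ?A u v \<or> ?A v u" for u v
  let ?P = "\<Sum>u\<in>S. w u * (\<Sum>v\<in>S. of_bool (?A u v) * w v)"
  let ?Q = "\<Sum>u\<in>S. w u * (\<Sum>v | v \<in> S \<and> R u v. w v)"
  have refl: "R u u" and sym: "R u v \<Longrightarrow> R v u" for u v
    by (auto simp: R_def)
  obtain I where I: "I \<subseteq> S" "\<And>u v. u \<in> I \<Longrightarrow> v \<in> I \<Longrightarrow> R u v \<Longrightarrow> u = v"
    "(\<Sum>v\<in>S. w v)\<^sup>2 \<le> card I * ?Q"
    by (rule weighted_turan[of S w R, OF fin w0 refl sym]) blast+
  have "?Q = (\<Sum>u\<in>S. \<Sum>v\<in>S. of_bool (R u v) * (w u * w v))"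
    using fin by (auto simp: sum_distrib_left sum.inter_filter of_bool_def intro!: sum.cong)
  also have "\<dots> \<le> (\<Sum>u\<in>S. \<Sum>v\<in>S. of_bool (?A u v) * (w u * w v) + of_bool (?A v u) * (w u * w v))"
    using w0 by (intro sum_mono) (auto simp: of_bool_def R_def)
  also have "\<dots> = (\<Sum>u\<in>S. \<Sum>v\<in>S. of_bool (?A u v) * (w u * w v)) +
      (\<Sum>u\<in>S. \<Sum>v\<in>S. of_bool (?A v u) * (w u * w v))"
    by (simp add: sum.distrib)
  also have "(\<Sum>u\<in>S. \<Sum>v\<in>S. of_bool (?A v u) * (w u * w v)) =
      (\<Sum>u\<in>S. \<Sum>v\<in>S. of_bool (?A u v) * (w u * w v))"
    by (subst sum.swap) (simp add: mult.commute)
  also have "(\<Sum>u\<in>S. \<Sum>v\<in>S. of_bool (?A u v) * (w u * w v)) = ?P"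
    by (simp add: sum_distrib_left mult.left_commute)
  finally have "card I * ?Q \<le> card I * (?P + ?P)" by (rule mult_left_mono) simp
  with I(3) have "(\<Sum>v\<in>S. w v)\<^sup>2 \<le> 2 * card I * ?P" by simp
  moreover have "u = v" if "u \<in> I" "v \<in> I" "E u v" for u v
    using that(1,2) by (rule I(2)) (simp add: R_def that(3))
  ultimately show thesis using I(1) by (intro that)
qed

section \<open>Bounds for the two graph parameters\<close>

lemma (in fin_digraph) card_le_independence_number:
  assumes "independent_set (with_proj (mk_symmetric G)) S"
  shows "card S \<le> independence_number G"
proof -
  let ?F = "{S. independent_set (with_proj (mk_symmetric G)) S}"
  have "?F \<subseteq> Pow (verts G)" by (auto simp: independent_set_mk_symmetric_iff)
  then have "finite ?F" by (rule finite_subset) simp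
  with assms show ?thesis unfolding independence_number_def by (intro Max_ge) auto
qed

text \<open>Either one term reaches 1 and suffices alone, or truncation changes nothing.\<close>

lemma one_le_sum_min_one:
  fixes f :: "'a \<Rightarrow> real"
  assumes "finite A" and "\<And>x. x \<in> A \<Longrightarrow> f x \<ge> 0" and "(\<Sum>x\<in>A. f x) \<ge> 1"
  shows "(\<Sum>x\<in>A. min 1 (f x)) \<ge> 1"
proof (cases "\<exists>x\<in>A. f x \<ge> 1")
  case True
  then obtain x where x: "x \<in> A" "f x \<ge> 1" by blast
  then have "1 = min 1 (f x)" by simp
  also have "\<dots> \<le> (\<Sum>x\<in>A. min 1 (f x))"
    using assms x by (intro member_le_sum) auto
  finally show ?thesis .
next
  case False
  then have "(\<Sum>x\<in>A. min 1 (f x)) = (\<Sum>x\<in>A. f x)" by (intro sum.cong) auto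
  with assms show ?thesis by simp
qed

text \<open>Scaling \<open>p\<close> by \<open>1 / c\<close> makes it dominating. Values may then
  exceed 1, so they are capped, which preserves domination and does not raise the total.\<close>

lemma (in fin_digraph) fractional_domination_number_le:
  assumes p0: "\<And>v. v \<in> verts G \<Longrightarrow> p v \<ge> 0" and p1: "(\<Sum>v\<in>verts G. p v) = 1"
    and c: "c > 0"
    and dom: "\<And>v. v \<in> verts G \<Longrightarrow> c \<le> (\<Sum>u\<in>closed_in_neighbors G v. p u)"
  shows "fractional_domination_number G \<le> 1 / c"
proof -
  define g where "g v = min 1 (p v / c)" for v
  have sub: "closed_in_neighbors G v \<subseteq> verts G" if "v \<in> verts G" for v
    using that by (auto simp: closed_in_neighbors_def in_neighbors_def)
  have "1 \<le> (\<Sum>x\<in>closed_in_neighbors G v. g x)" if v: "v \<in> verts G" for v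
    unfolding g_def
  proof (rule one_le_sum_min_one)
    show "finite (closed_in_neighbors G v)" using sub[OF v] by (rule finite_subset) simp
    show "1 \<le> (\<Sum>x\<in>closed_in_neighbors G v. p x / c)"
      using dom[OF v] c by (simp flip: sum_divide_distrib)
  qed (use sub[OF v] p0 c in auto)
  then have "fractional_dominating_function G g"
    using p0 c by (auto simp: fractional_dominating_function_def g_def)
  then have "fractional_domination_number G \<le> (\<Sum>v\<in>verts G. g v)"
    by (metis fractional_domination_number_attained)
  also have "\<dots> \<le> (\<Sum>v\<in>verts G. p v / c)" by (intro sum_mono) (simp add: g_def)
  also have "\<dots> = 1 / c" using p1 by (simp flip: sum_divide_distrib)
  finally show ?thesis .
qed

theorem theorem1:
  fixes G :: "('a, 'b) pre_digraph"
  assumes "simple_digraph G"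
  shows "fractional_domination_number G \<le> 2 * real (independence_number G)"
proof -
  interpret simple_digraph G by fact
  define \<alpha> where "\<alpha> = real (independence_number G)"
  \<comment> \<open>Column \<open>v\<close> of \<open>A\<close> marks the closed in-neighborhood of
    \<open>v\<close>, as domination requires; row \<open>u\<close> marks the closed out-neighborhood
    of \<open>u\<close>, which the dual weights see.\<close>
  define A :: "'a \<Rightarrow> 'a \<Rightarrow> real" where "A u v = of_bool (u = v \<or> u \<rightarrow>\<^bsub>G\<^esub> v)" for u v
  have irrefl: "\<not> v \<rightarrow>\<^bsub>G\<^esub> v" for v using adj_not_same by blast
  show ?thesis
  proof (cases "verts G = {}")
    case True
    then show ?thesis
      using fractional_domination_number_attained by (metis sum.empty of_nat_0_le_iff mult_nonneg_nonneg zero_le_numeral)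
  next
    case False
    then obtain z where z: "z \<in> verts G" by auto
    \<comment> \<open>A single vertex is independent, so the threshold
      \<open>1 / (2 * \<alpha>)\<close> is a genuine positive number.\<close>
    have "card {z} \<le> independence_number G"
      using z irrefl by (intro card_le_independence_number) (simp add: independent_set_mk_symmetric_iff)
    then have \<alpha>: "\<alpha> \<ge> 1" by (simp add: \<alpha>_def)
    show ?thesis
    proof (rule ville_alternative[OF finite_verts False, of "1 / (2 * \<alpha>)" A])
      fix p assume p: "\<And>v. v \<in> verts G \<Longrightarrow> p v \<ge> 0" "(\<Sum>v\<in>verts G. p v) = 1"
        "\<And>v. v \<in> verts G \<Longrightarrow> 1 / (2 * \<alpha>) \<le> (\<Sum>u\<in>verts G. A u v * p u)"
      have "(\<Sum>u\<in>verts G. A u v * p u) = (\<Sum>u\<in>closed_in_neighbors G v. p u)" if "v \<in> verts G" for v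
      proof -
        have "closed_in_neighbors G v = {u \<in> verts G. u = v \<or> u \<rightarrow>\<^bsub>G\<^esub> v}"
          using that by (auto simp: closed_in_neighbors_def in_neighbors_def)
        then show ?thesis
          by (auto simp: sum.inter_filter A_def of_bool_def intro!: sum.cong)
      qed
      with p \<alpha> have "fractional_domination_number G \<le> 1 / (1 / (2 * \<alpha>))"
        by (intro fractional_domination_number_le[of p]) auto
      then show ?thesis by (simp add: \<alpha>_def)
    next
      fix w assume w: "\<And>v. v \<in> verts G \<Longrightarrow> w v \<ge> 0" "(\<Sum>v\<in>verts G. w v) > 0"
        "\<And>u. u \<in> verts G \<Longrightarrow> (\<Sum>v\<in>verts G. A u v * w v) < 1 / (2 * \<alpha>) * (\<Sum>v\<in>verts G. w v)"
      define W where "W = (\<Sum>v\<in>verts G. w v)"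
      define P where "P = (\<Sum>u\<in>verts G. w u * (\<Sum>v\<in>verts G. A u v * w v))"
      obtain I where I: "I \<subseteq> verts G" "\<And>u v. u \<in> I \<Longrightarrow> v \<in> I \<Longrightarrow> u \<rightarrow>\<^bsub>G\<^esub> v \<Longrightarrow> u = v"
        "W\<^sup>2 \<le> 2 * card I * P"
        unfolding W_def P_def A_def
        by (rule weighted_turan_oriented[of "verts G" w "\<lambda>u v. u \<rightarrow>\<^bsub>G\<^esub> v"]) (use w in auto)
      \<comment> \<open>Adjacency inside \<open>I\<close> would force equality, which looplessness
        excludes.\<close>
      have "card I \<le> independence_number G"
        using I(1,2) irrefl by (intro card_le_independence_number) (auto simp: independent_set_mk_symmetric_iff)
      then have "card I \<le> \<alpha>" by (simp add: \<alpha>_def)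
      moreover have "P \<ge> 0"
        unfolding P_def A_def using w(1) by (auto intro!: sum_nonneg mult_nonneg_nonneg)
      ultimately have "W\<^sup>2 \<le> 2 * \<alpha> * P"
        using I(3) mult_right_mono[of "card I" \<alpha> "2 * P"] by simp
      \<comment> \<open>Average the dual inequalities with weights \<open>w\<close>; strictness
        survives at a vertex of positive weight, which exists because the total is positive.\<close>
      moreover have "P < (\<Sum>u\<in>verts G. w u * (1 / (2 * \<alpha>) * W))"
        unfolding P_def
      proof (rule sum_strict_mono_ex1)
        show "\<forall>u\<in>verts G. w u * (\<Sum>v\<in>verts G. A u v * w v) \<le> w u * (1 / (2 * \<alpha>) * W)"
          using w(1) w(3)[THEN less_imp_le] unfolding W_def by (intro ballI mult_left_mono)
        obtain u where "u \<in> verts G" "w u > 0"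
          using w(2) by (meson not_less sum_nonpos)
        then show "\<exists>u\<in>verts G. w u * (\<Sum>v\<in>verts G. A u v * w v) < w u * (1 / (2 * \<alpha>) * W)"
          using w(3) unfolding W_def by (intro bexI[of _ u] mult_strict_left_mono) auto
      qed simp
      then have "P < W * (1 / (2 * \<alpha>) * W)" by (simp only: W_def flip: sum_distrib_right)
      then have "2 * \<alpha> * P < W\<^sup>2" using \<alpha> by (simp add: field_simps power2_eq_square)
      ultimately show ?thesis by simp
    qed
  qed
qed

end
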